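(* Let $\alpha,\beta\ge 0$ be real numbers with $\alpha+\beta>0$, let $a<b$ be real numbers, and let $f,g:\mathbb{R}\to\mathbb{R}$ be $\alpha,\beta$-symmetric integrable on $[a,b]$. Put $\mathcal{A}:=\{a+k\alpha: k\in\mathbb{N}_0\}$ and $\mathcal{B}:=\{b-k\beta: k\in\mathbb{N}_0\}$, and suppose $b\in\mathcal{A}$ and $a\in\mathcal{B}$. Then: 1. if $|f(t)|\leq g(t)$ for all $t\in\mathcal{A}\cup\mathcal{B}$, then $\left|\int_a^b f(t)\,d_{\alpha,\beta}t\right|\leq\int_a^b g(t)\,d_{\alpha,\beta}t$; 2. if $f(t)\geq 0$ for all $t\in\mathcal{A}\cup\mathcal{B}$, then $\int_a^b f(t)\,d_{\alpha,\beta}t\geq 0$; 3. if $g(t)\geq f(t)$ for all $t\in\mathcal{A}\cup\mathcal{B}$, then $\int_a^b g(t)\,d_{\alpha,\beta}t\geq\int_a^b f(t)\,d_{\alpha,\beta}t$.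
   Context: $\mathbb{N}_0=\{0,1,2,\dots\}$. Let $h:\mathbb{R}\to\mathbb{R}$ and $a<b$ be reals. For $\alpha>0$, $h$ is $\alpha$-forward integrable on $[a,b]$ if the series $\int_x^{+\infty}h(t)\Delta_\alpha t:=\alpha\sum_{k=0}^{+\infty}h(x+k\alpha)$ converges for $x=a$ and $x=b$; then $\int_a^b h(t)\Delta_\alpha t:=\int_a^{+\infty}h(t)\Delta_\alpha t-\int_b^{+\infty}h(t)\Delta_\alpha t$. For $\beta>0$, $h$ is $\beta$-backward integrable on $[a,b]$ if the series $\int_{-\infty}^x h(t)\nabla_\beta t:=\beta\sum_{k=0}^{+\infty}h(x-k\beta)$ converges for $x=a$ and $x=b$; then $\int_a^b h(t)\nabla_\beta t:=\int_{-\infty}^b h(t)\nabla_\beta t-\int_{-\infty}^a h(t)\nabla_\beta t$. For $\alpha,\beta\ge 0$ with $\alpha+\beta>0$, $h$ is $\alpha,\beta$-symmetric integrable on $[a,b]$ if it is $\alpha$-forward integrable and $\beta$-backward integrable on $[a,b]$ (the forward requirement is dropped if $\alpha=0$, and the backward requirement is dropped if $\beta=0$); then $$\int_a^b h(t)\,d_{\alpha,\beta}t:=\frac{\alpha}{\alpha+\beta}\int_a^b h(t)\Delta_\alpha t+\frac{\beta}{\alpha+\beta}\int_a^b h(t)\nabla_\beta t,$$ where a term with zero coefficient is omitted. *)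

theory Defs
  imports Complex_Main
begin

definition forward_tail :: "real \<Rightarrow> (real \<Rightarrow> real) \<Rightarrow> real \<Rightarrow> real" where
  "forward_tail \<alpha> h x = \<alpha> * (\<Sum>k. h (x + real k * \<alpha>))"

definition forward_integrable :: "real \<Rightarrow> (real \<Rightarrow> real) \<Rightarrow> real \<Rightarrow> real \<Rightarrow> bool" where
  "forward_integrable \<alpha> h a b \<longleftrightarrow>
     summable (\<lambda>k. h (a + real k * \<alpha>)) \<and> summable (\<lambda>k. h (b + real k * \<alpha>))"

definition forward_integral :: "real \<Rightarrow> (real \<Rightarrow> real) \<Rightarrow> real \<Rightarrow> real \<Rightarrow> real" where
  "forward_integral \<alpha> h a b = forward_tail \<alpha> h a - forward_tail \<alpha> h b"

definition backward_tail :: "real \<Rightarrow> (real \<Rightarrow> real) \<Rightarrow> real \<Rightarrow> real" where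
  "backward_tail \<beta> h x = \<beta> * (\<Sum>k. h (x - real k * \<beta>))"

definition backward_integrable :: "real \<Rightarrow> (real \<Rightarrow> real) \<Rightarrow> real \<Rightarrow> real \<Rightarrow> bool" where
  "backward_integrable \<beta> h a b \<longleftrightarrow>
     summable (\<lambda>k. h (a - real k * \<beta>)) \<and> summable (\<lambda>k. h (b - real k * \<beta>))"

definition backward_integral :: "real \<Rightarrow> (real \<Rightarrow> real) \<Rightarrow> real \<Rightarrow> real \<Rightarrow> real" where
  "backward_integral \<beta> h a b = backward_tail \<beta> h b - backward_tail \<beta> h a"

definition symmetric_integrable ::
  "real \<Rightarrow> real \<Rightarrow> (real \<Rightarrow> real) \<Rightarrow> real \<Rightarrow> real \<Rightarrow> bool" where
  "symmetric_integrable \<alpha> \<beta> h a b \<longleftrightarrow>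
     (\<alpha> \<noteq> 0 \<longrightarrow> forward_integrable \<alpha> h a b) \<and> (\<beta> \<noteq> 0 \<longrightarrow> backward_integrable \<beta> h a b)"

(* A term with zero coefficient vanishes here, as 0 * y = 0 whatever the (unspecified)
   value y of the corresponding integral; so it is omitted automatically. *)
definition symmetric_integral ::
  "real \<Rightarrow> real \<Rightarrow> (real \<Rightarrow> real) \<Rightarrow> real \<Rightarrow> real \<Rightarrow> real" where
  "symmetric_integral \<alpha> \<beta> h a b =
     \<alpha> / (\<alpha> + \<beta>) * forward_integral \<alpha> h a b + \<beta> / (\<alpha> + \<beta>) * backward_integral \<beta> h a b"

end

theory Submission
  imports Defs
begin

text \<open>The two series defining a forward integral run along the same lattice when
  \<open>b\<close> is a lattice point \<open>a + m \<alpha>\<close>: the second series is the tail of the first, so the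
  difference telescopes to a finite Riemann sum over the \<open>m\<close> lattice points from \<open>a\<close> up to,
  but excluding, \<open>b\<close> (\<open>forward_integral_eq_sum\<close>). Reflection turns this into the backward
  version, a finite sum over lattice points from \<open>b\<close> down to, but excluding, \<open>a\<close>
  (\<open>backward_integral_eq_sum\<close>). Since \<open>a < b\<close>, the conditions \<open>b \<in> A\<close> and \<open>a \<in> B\<close>
  force both \<open>\<alpha>\<close> and \<open>\<beta>\<close> to be positive, so no term degenerates and the symmetric integral is
  a linear functional that sums values on \<open>A \<union> B\<close> with nonnegative weights. Such a functional
  is monotone; nonnegativity and the bound on the absolute value are monotonicity applied to
  \<open>0 \<le> f\<close> and to \<open>- g \<le> f \<le> g\<close>.\<close>

lemma forward_integral_eq_sum:
  assumes "forward_integrable \<alpha> h a b" and b: "b = a + real m * \<alpha>"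
  shows "forward_integral \<alpha> h a b = \<alpha> * (\<Sum>k<m. h (a + real k * \<alpha>))"
proof -
  have "summable (\<lambda>k. h (a + real k * \<alpha>))"
    using assms(1) by (simp add: forward_integrable_def)
  from suminf_split_initial_segment[OF this, of m]
  have "(\<Sum>k. h (a + real k * \<alpha>)) =
        (\<Sum>k. h (b + real k * \<alpha>)) + (\<Sum>k<m. h (a + real k * \<alpha>))"
    by (simp add: b algebra_simps)
  then show ?thesis
    by (simp add: forward_integral_def forward_tail_def algebra_simps)
qed

text \<open>The reflection \<open>t \<mapsto> - t\<close> exchanges the two directions of summation and the two endpoints.\<close>

lemma backward_integral_eq_forward_integral:
  "backward_integral \<beta> h a b = forward_integral \<beta> (\<lambda>t. h (- t)) (- b) (- a)"
  by (simp add: backward_integral_def forward_integral_def backward_tail_def forward_tail_def)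

lemma backward_integrable_iff_forward_integrable:
  "backward_integrable \<beta> h a b \<longleftrightarrow> forward_integrable \<beta> (\<lambda>t. h (- t)) (- b) (- a)"
  by (auto simp: backward_integrable_def forward_integrable_def)

lemma backward_integral_eq_sum:
  assumes "backward_integrable \<beta> h a b" and "a = b - real n * \<beta>"
  shows "backward_integral \<beta> h a b = \<beta> * (\<Sum>k<n. h (b - real k * \<beta>))"
  using forward_integral_eq_sum[of \<beta> "\<lambda>t. h (- t)" "- b" "- a" n] assms
  by (simp add: backward_integral_eq_forward_integral backward_integrable_iff_forward_integrable)

theorem theorem8:
  fixes \<alpha> \<beta> a b :: real and f g :: "real \<Rightarrow> real" and A B :: "real set"
  assumes "\<alpha> \<ge> 0" and "\<beta> \<ge> 0" and "\<alpha> + \<beta> > 0" and "a < b"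
    and "symmetric_integrable \<alpha> \<beta> f a b" and "symmetric_integrable \<alpha> \<beta> g a b"
    and "A = {a + real k * \<alpha> | k :: nat. True}"
    and "B = {b - real k * \<beta> | k :: nat. True}"
    and "b \<in> A" and "a \<in> B"
  shows "((\<forall>t \<in> A \<union> B. \<bar>f t\<bar> \<le> g t) \<longrightarrow>
            \<bar>symmetric_integral \<alpha> \<beta> f a b\<bar> \<le> symmetric_integral \<alpha> \<beta> g a b)
       \<and> ((\<forall>t \<in> A \<union> B. f t \<ge> 0) \<longrightarrow> symmetric_integral \<alpha> \<beta> f a b \<ge> 0)
       \<and> ((\<forall>t \<in> A \<union> B. g t \<ge> f t) \<longrightarrow>
            symmetric_integral \<alpha> \<beta> g a b \<ge> symmetric_integral \<alpha> \<beta> f a b)"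
proof -
  obtain m where m: "b = a + real m * \<alpha>" using assms by auto
  obtain n where n: "a = b - real n * \<beta>" using assms by auto
  have nz: "\<alpha> \<noteq> 0" "\<beta> \<noteq> 0" using m n \<open>a < b\<close> by auto
  define W where "W h = \<alpha> / (\<alpha> + \<beta>) * (\<alpha> * (\<Sum>k<m. h (a + real k * \<alpha>)))
      + \<beta> / (\<alpha> + \<beta>) * (\<beta> * (\<Sum>k<n. h (b - real k * \<beta>)))" for h :: "real \<Rightarrow> real"
  have W: "symmetric_integral \<alpha> \<beta> h a b = W h" if "symmetric_integrable \<alpha> \<beta> h a b" for h
    using that nz forward_integral_eq_sum[OF _ m] backward_integral_eq_sum[OF _ n]
    by (simp add: symmetric_integrable_def symmetric_integral_def W_def)
  have W_mono: "W u \<le> W v" if "\<And>t. t \<in> A \<union> B \<Longrightarrow> u t \<le> v t" for u v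
  proof -
    have "(\<Sum>k<m. u (a + real k * \<alpha>)) \<le> (\<Sum>k<m. v (a + real k * \<alpha>))"
      by (rule sum_mono, rule that) (auto simp: assms(7))
    moreover have "(\<Sum>k<n. u (b - real k * \<beta>)) \<le> (\<Sum>k<n. v (b - real k * \<beta>))"
      by (rule sum_mono, rule that) (auto simp: assms(8))
    ultimately show ?thesis
      unfolding W_def using assms(1-3) by (intro add_mono mult_left_mono) auto
  qed
  have W_zero: "W (\<lambda>t. 0) = 0" by (simp add: W_def)
  have W_uminus: "W (\<lambda>t. - h t) = - W h" for h by (simp add: W_def sum_negf)
  have "\<bar>W f\<bar> \<le> W g" if bound: "\<forall>t \<in> A \<union> B. \<bar>f t\<bar> \<le> g t"
  proof -
    have "W f \<le> W g" by (rule W_mono) (use bound in force)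
    moreover have "W (\<lambda>t. - g t) \<le> W f" by (rule W_mono) (use bound in force)
    ultimately show ?thesis by (simp add: W_uminus)
  qed
  moreover have "0 \<le> W f" if "\<forall>t \<in> A \<union> B. f t \<ge> 0"
    using W_mono[of "\<lambda>t. 0" f] that by (simp add: W_zero)
  moreover have "W f \<le> W g" if "\<forall>t \<in> A \<union> B. g t \<ge> f t"
    using W_mono[of f g] that by simp
  ultimately show ?thesis using W assms(5,6) by simp
qed

end
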